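(* For every integer $m\ge 1$ and every weak order $w$ on $[m]=\{1,\ldots,m\}$, there is a graph $G$ with $\alpha(G)=m$ and with at most $m^{m+2}$ vertices (and, when $m\ge 2$, with fewer than $m^{m+2}$ vertices) which induces $w$.
   Context: All graphs are finite and simple. $\alpha(G)$ is the size of the largest independent set (set of mutually non-adjacent vertices) of $G$, and $i_k(G)$ is the number of independent sets of size $k$ in $G$. A weak order on $[m]$ is an ordered partition $(B_1,\ldots,B_\ell)$ of $[m]$ into non-empty blocks. A real sequence $(a_1,\ldots,a_m)$ induces the unique weak order $(B_1,\ldots,B_\ell)$ on $[m]$ such that $a_s=a_t$ whenever $s,t$ lie in the same block, and $a_s<a_t$ whenever $s\in B_i$, $t\in B_j$ with $i<j$. A graph $G$ with $\alpha(G)=m$ induces the weak order $w$ if its independent set sequence $(i_1(G),\ldots,i_m(G))$ induces $w$. *)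

theory Defs
  imports Complex_Main "HOL-Library.Disjoint_Sets" "Graph_Theory.Pair_Digraph"
begin

text \<open>
  Finite simple graphs are rendered by the locale \<^locale>\<open>pair_graph\<close>: a finite vertex set
  together with a symmetric, irreflexive set of ordered pairs of vertices.
\<close>

definition independent_set :: "'a pair_pre_digraph \<Rightarrow> 'a set \<Rightarrow> bool" where
  "independent_set G S \<longleftrightarrow> S \<subseteq> pverts G \<and> (\<forall>u\<in>S. \<forall>v\<in>S. (u, v) \<notin> parcs G)"

definition independence_number :: "'a pair_pre_digraph \<Rightarrow> nat" where
  "independence_number G = Max (card ` {S. independent_set G S})"

definition num_independent_sets :: "'a pair_pre_digraph \<Rightarrow> nat \<Rightarrow> nat" where
  "num_independent_sets G k = card {S. independent_set G S \<and> card S = k}"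

text \<open>
  A weak order is the list of its blocks. Distinctness is needed in addition to
  \<^const>\<open>partition_on\<close>, which only sees the set of blocks.
\<close>

definition weak_order :: "nat \<Rightarrow> nat set list \<Rightarrow> bool" where
  "weak_order m w \<longleftrightarrow> distinct w \<and> partition_on {1..m} (set w)"

text \<open>
  The sequence \<open>a\<^sub>1, \<dots>, a\<^sub>m\<close> is given by the values of \<open>a\<close> on \<open>{1..m}\<close>; its other values
  are irrelevant.
\<close>

definition seq_induces :: "nat \<Rightarrow> (nat \<Rightarrow> real) \<Rightarrow> nat set list \<Rightarrow> bool" where
  "seq_induces m a w \<longleftrightarrow> weak_order m w \<and>
     (\<forall>i<length w. \<forall>s\<in>w ! i. \<forall>t\<in>w ! i. a s = a t) \<and>
     (\<forall>i<length w. \<forall>j<length w. i < j \<longrightarrow> (\<forall>s\<in>w ! i. \<forall>t\<in>w ! j. a s < a t))"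

definition graph_induces :: "'a pair_pre_digraph \<Rightarrow> nat set list \<Rightarrow> bool" where
  "graph_induces G w \<longleftrightarrow>
     seq_induces (independence_number G) (\<lambda>k. real (num_independent_sets G k)) w"

end

theory Submission
  imports Defs "HOL-Library.FuncSet" "HOL-Library.Countable"
begin

text \<open>
  Joining graphs (adding all edges between them) adds their numbers of independent sets of each
  positive size, because a non-empty independent set lies within a single component of the join.
  The disjoint union of \<open>i\<close> cliques on \<open>n\<close> vertices has \<open>(i choose k) * n ^ k\<close> independent sets of
  size \<open>k\<close>. So the join of \<open>c i\<close> copies of this graph for each \<open>i \<le> m\<close> has
  \<open>(\<Sum>i=k..m. (i choose k) * c i) * n ^ k\<close> of them. Finding a graph with a prescribed independent
  set sequence \<open>s k * n ^ k\<close> thus comes down to solving a unitriangular linear system in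
  non-negative integers, and this is possible as soon as
  \<open>(k + 1) * s (k + 1) \<le> s k\<close> (\<open>nat_binomial_system_solvable\<close>).

  For \<open>m \<ge> 2\<close>, the chosen sequence is nearly constant: with \<open>n = m + 1\<close> and with \<open>\<rho> k < m\<close> the index of the
  block that contains \<open>k\<close>, the number of independent sets of size \<open>k\<close> is
  \<open>(m\<^sup>2 - 1 + \<rho> k - \<rho> m) * n ^ (m - 1)\<close>, which is ordered as \<open>\<rho>\<close> is. Two features make this work.
  First, it is divisible by \<open>n ^ k\<close> for every \<open>k \<le> m\<close>. For \<open>k = m\<close> this holds because the ranks are
  shifted by \<open>\<rho> m\<close>, which leaves \<open>m\<^sup>2 - 1 = (m - 1) * n\<close>. Secondly, the factors in front of
  \<open>n ^ (m - 1)\<close> are at least \<open>m * (m - 1)\<close> and differ by at most \<open>m - 1\<close>, so two of them have ratio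
  at most \<open>(m + 1) / m\<close>; division by \<open>n = m + 1\<close> gives \<open>s (k + 1) / s k \<le> 1 / m \<le> 1 / (k + 1)\<close>.
  The number of vertices is
  the number of independent sets of size 1, so it is less than
  \<open>m * (m + 1) * (m + 1) ^ (m - 1) = m * (m + 1) ^ m\<close>. This is at most \<open>m ^ (m + 2)\<close> for \<open>m \<ge> 3\<close>,
  because \<open>(1 + 1 / m) ^ m < e < 3\<close>; for \<open>m = 2\<close> the number of vertices is at most 12, below 16.
  For \<open>m = 1\<close> a single vertex suffices.
\<close>

section \<open>Independent set numbers\<close>

lemma num_independent_sets_1_eq_card:
  assumes "pair_graph G"
  shows "num_independent_sets G 1 = card (pverts G)"
proof -
  interpret pair_graph G by fact
  have "{S. independent_set G S \<and> card S = 1} = (\<lambda>v. {v}) ` pverts G"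
    using no_loops' by (auto simp: independent_set_def card_1_singleton_iff)
  thus ?thesis
    by (simp add: num_independent_sets_def card_image)
qed

lemma independence_number_eqI:
  assumes G: "pair_graph G" and pos: "num_independent_sets G m > 0"
    and zero: "\<And>k. k > m \<Longrightarrow> num_independent_sets G k = 0"
  shows "independence_number G = m"
proof -
  interpret pair_graph G by fact
  have "{S. independent_set G S} \<subseteq> Pow (pverts G)"
    by (auto simp: independent_set_def)
  hence fin: "finite {S. independent_set G S}"
    using finite_subset pair_finite_verts by blast
  have "\<exists>S. independent_set G S \<and> card S = m"
    using pos unfolding num_independent_sets_def by (auto simp: card_gt_0_iff)
  moreover have "card S \<le> m" if "independent_set G S" for S
  proof (rule ccontr)
    assume "\<not> card S \<le> m"
    hence "num_independent_sets G (card S) = 0"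
      using zero by simp
    moreover have "finite {S'. independent_set G S' \<and> card S' = card S}"
      using fin by (rule finite_subset[rotated]) auto
    ultimately show False
      using that by (auto simp: num_independent_sets_def)
  qed
  ultimately show ?thesis
    unfolding independence_number_def by (intro Max_eqI) (use fin in auto)
qed

text \<open>
  Joins are most naturally built on tuples; an injection into the natural numbers then transports
  them.
\<close>

lemma pair_graph_relabel:
  fixes G :: "'a pair_pre_digraph" and f :: "'a \<Rightarrow> 'b"
  assumes G: "pair_graph G" and f: "inj f"
  obtains H :: "'b pair_pre_digraph"
    where "pair_graph H" and "\<And>k. num_independent_sets H k = num_independent_sets G k"
proof
  interpret pair_graph G by fact
  define H where "H = \<lparr>pverts = f ` pverts G, parcs = map_prod f f ` parcs G\<rparr>"
  show "pair_graph H"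
  proof
    show "symmetric H"
      using pair_sym_arcs
      by (fastforce simp: symmetric_def sym_def H_def)
  qed (use pair_finite_verts pair_finite_arcs in_arcsD1 in_arcsD2 no_loops' f in
        \<open>auto simp: H_def inj_eq\<close>)
  fix k
  have "{S. independent_set H S \<and> card S = k} = (`) f ` {S. independent_set G S \<and> card S = k}"
    (is "?L = ?R")
  proof (intro equalityI subsetI)
    fix S assume S: "S \<in> ?L"
    then obtain T where T: "T \<subseteq> pverts G" "S = f ` T"
      by (auto simp: independent_set_def H_def subset_image_iff)
    have "card T = card S"
      using T f by (metis card_image inj_on_subset subset_UNIV)
    with S T have "T \<in> {S. independent_set G S \<and> card S = k}"
      by (force simp: independent_set_def H_def)
    thus "S \<in> ?R"
      using T by blast
  next
    fix S assume "S \<in> ?R"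
    then obtain T where T: "independent_set G T" "card T = k" "S = f ` T"
      by blast
    thus "S \<in> ?L"
      using f by (auto simp: independent_set_def H_def inj_eq card_image inj_on_subset[OF f])
  qed
  thus "num_independent_sets H k = num_independent_sets G k"
    unfolding num_independent_sets_def
    using f by (simp add: card_image inj_on_def inj_image_eq_iff)
qed

section \<open>Joins of unions of cliques\<close>

text \<open>
  A set of pairs on which the first projection is injective is the graph of a function on its
  domain \<open>T\<close>, so there are \<open>card B ^ k\<close> such sets for each choice of \<open>T\<close> of size \<open>k\<close>.
\<close>

lemma card_partial_transversals:
  assumes "finite A" and "finite B"
  shows "card {S. S \<subseteq> A \<times> B \<and> inj_on fst S \<and> card S = k} = (card A choose k) * card B ^ k"
proof -
  let ?graph = "\<lambda>(T, f). (\<lambda>p. (p, f p)) ` T"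
  let ?D = "SIGMA T:{T. T \<subseteq> A \<and> card T = k}. T \<rightarrow>\<^sub>E B"
  have inj: "inj_on ?graph ?D"
  proof (rule inj_onI, clarify, intro conjI)
    fix T f U g
    assume f: "f \<in> T \<rightarrow>\<^sub>E B" and g: "g \<in> U \<rightarrow>\<^sub>E B"
      and eq: "(\<lambda>p. (p, f p)) ` T = (\<lambda>p. (p, g p)) ` U"
    have "fst ` (\<lambda>p. (p, f p)) ` T = fst ` (\<lambda>p. (p, g p)) ` U"
      by (simp only: eq)
    thus TU: "T = U"
      by (simp add: image_image)
    show "f = g"
    proof (rule PiE_ext[OF f])
      show "g \<in> T \<rightarrow>\<^sub>E B" using g TU by simp
      fix p assume "p \<in> T"
      hence "(p, f p) \<in> (\<lambda>p. (p, g p)) ` U"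
        using eq by blast
      thus "f p = g p" by auto
    qed
  qed
  have "{S. S \<subseteq> A \<times> B \<and> inj_on fst S \<and> card S = k} = ?graph ` ?D"
  proof (intro equalityI subsetI)
    fix S assume "S \<in> {S. S \<subseteq> A \<times> B \<and> inj_on fst S \<and> card S = k}"
    hence S: "S \<subseteq> A \<times> B" "inj_on fst S" "card S = k" by auto
    define f where "f = restrict (\<lambda>p. THE q. (p, q) \<in> S) (fst ` S)"
    have f: "f p = q" if "(p, q) \<in> S" for p q
    proof -
      have "(THE q. (p, q) \<in> S) = q"
        using that S(2) by (intro the_equality) (auto dest: inj_onD[of fst S "(p, _)" "(p, q)"])
      thus ?thesis
        using that by (force simp: f_def)
    qed
    have "?graph (fst ` S, f) = S"
      using f by (force simp: image_iff)
    moreover have "f \<in> fst ` S \<rightarrow>\<^sub>E B"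
    proof
      fix p assume "p \<in> fst ` S"
      then obtain q where "(p, q) \<in> S" by force
      thus "f p \<in> B" using f S(1) by auto
    qed (auto simp: f_def)
    hence "(fst ` S, f) \<in> ?D"
      using S by (auto simp: card_image)
    ultimately show "S \<in> ?graph ` ?D"
      by (metis (no_types, lifting) image_eqI)
  next
    fix S assume "S \<in> ?graph ` ?D"
    then obtain T f where T: "T \<subseteq> A" "card T = k" "f \<in> T \<rightarrow>\<^sub>E B" "S = (\<lambda>p. (p, f p)) ` T"
      by auto
    have "inj_on (\<lambda>p. (p, f p)) T"
      by (auto intro: inj_onI)
    with T show "S \<in> {S. S \<subseteq> A \<times> B \<and> inj_on fst S \<and> card S = k}"
      by (auto simp: card_image PiE_mem subset_iff inj_on_def)
  qed
  moreover have "card ?D = (card A choose k) * card B ^ k"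
  proof -
    have "finite {T. T \<subseteq> A \<and> card T = k}"
      using assms by simp
    moreover have "finite (T \<rightarrow>\<^sub>E B)" if "T \<subseteq> A" for T
      using assms that by (intro finite_PiE) (auto intro: finite_subset)
    ultimately have "card ?D = (\<Sum>T\<in>{T. T \<subseteq> A \<and> card T = k}. card (T \<rightarrow>\<^sub>E B))"
      by (intro card_SigmaI) auto
    also have "\<dots> = (\<Sum>T\<in>{T. T \<subseteq> A \<and> card T = k}. card B ^ k)"
      using assms by (intro sum.cong) (auto simp: card_PiE finite_subset)
    also have "\<dots> = (card A choose k) * card B ^ k"
      using assms by (simp add: n_subsets)
    finally show ?thesis .
  qed
  ultimately show ?thesis
    using inj by (simp add: card_image)
qed

text \<open>
  Vertex \<open>(b, p, q)\<close> is the \<open>q\<close>-th vertex of the \<open>p\<close>-th clique of component \<open>b\<close>. Components are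
  indexed by an arbitrary set so that several of them may have the same number of cliques.
\<close>

definition clique_union_join :: "'b set \<Rightarrow> ('b \<Rightarrow> nat) \<Rightarrow> nat \<Rightarrow> ('b \<times> nat \<times> nat) pair_pre_digraph"
  where "clique_union_join I d n =
    (let V = (SIGMA b:I. {..<d b} \<times> {..<n}) in
      \<lparr>pverts = V,
       parcs = {((b, p, q), (b', p', q')). (b, p, q) \<in> V \<and> (b', p', q') \<in> V \<and>
                  (b \<noteq> b' \<or> p = p' \<and> q \<noteq> q')}\<rparr>)"

lemma pair_graph_clique_union_join:
  assumes "finite I"
  shows "pair_graph (clique_union_join I d n)"
proof -
  let ?V = "SIGMA b:I. {..<d b} \<times> {..<n}"
  have V: "finite ?V"
    using assms by auto
  show ?thesis
  proof
    show "finite (pverts (clique_union_join I d n))"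
      using V by (simp add: clique_union_join_def Let_def)
    show "finite (parcs (clique_union_join I d n))"
      by (rule finite_subset[of _ "?V \<times> ?V"]) (use V in \<open>auto simp: clique_union_join_def\<close>)
  qed (auto simp: clique_union_join_def symmetric_def sym_def Let_def)
qed

text \<open>
  Vertices of different components are adjacent, and so are vertices of the same clique; no other
  pairs are. Only a non-empty \<open>S\<close> determines its component \<open>b\<close>, which is why the numbers of
  independent sets of positive size simply add up.
\<close>

lemma independent_set_clique_union_join_iff:
  assumes "S \<noteq> {}"
  shows "independent_set (clique_union_join I d n) S \<longleftrightarrow>
    (\<exists>b\<in>I. \<exists>P. S = Pair b ` P \<and> P \<subseteq> {..<d b} \<times> {..<n} \<and> inj_on fst P)"
    (is "?L \<longleftrightarrow> ?R")
proof
  assume L: ?L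
  obtain b p q where bpq: "(b, p, q) \<in> S"
    using assms by (metis ex_in_conv prod_cases3)
  have same: "b' = b" if "(b', p', q') \<in> S" for b' p' q'
    using L bpq that by (fastforce simp: independent_set_def clique_union_join_def)
  define P where "P = snd ` S"
  have S: "S = Pair b ` P"
    using same by (force simp: P_def image_iff)
  moreover have "b \<in> I" "P \<subseteq> {..<d b} \<times> {..<n}"
    using L bpq unfolding S by (auto simp: independent_set_def clique_union_join_def)
  moreover have "inj_on fst P"
  proof (rule inj_onI, clarsimp)
    fix p q q' assume "(p, q) \<in> P" "(p, q') \<in> P"
    thus "q = q'"
      using L unfolding S by (force simp: independent_set_def clique_union_join_def)
  qed
  ultimately show ?R by blast
next
  assume ?R
  then obtain b P where P: "b \<in> I" "S = Pair b ` P" "P \<subseteq> {..<d b} \<times> {..<n}" and inj: "inj_on fst P"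
    by blast
  have "q = q'" if "(p, q) \<in> P" "(p, q') \<in> P" for p q q'
    using inj_onD[OF inj _ that] by simp
  with P show ?L
    by (auto simp: independent_set_def clique_union_join_def)
qed

lemma num_independent_sets_clique_union_join:
  assumes I: "finite I" and k: "k \<ge> 1"
  shows "num_independent_sets (clique_union_join I d n) k = (\<Sum>b\<in>I. (d b choose k) * n ^ k)"
proof -
  define Q where "Q b = {P. P \<subseteq> {..<d b} \<times> {..<n} \<and> inj_on fst P \<and> card P = k}" for b
  have fin: "finite (Q b)" for b
    by (rule finite_subset[of _ "Pow ({..<d b} \<times> {..<n})"]) (auto simp: Q_def)
  have "{S. independent_set (clique_union_join I d n) S \<and> card S = k} =
      (\<Union>b\<in>I. (`) (Pair b) ` Q b)"
  proof (intro equalityI subsetI)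
    fix S assume "S \<in> {S. independent_set (clique_union_join I d n) S \<and> card S = k}"
    moreover from this have "S \<noteq> {}" using k by auto
    ultimately obtain b P where "b \<in> I" "S = Pair b ` P" "P \<subseteq> {..<d b} \<times> {..<n}" "inj_on fst P"
        "card S = k"
      by (auto simp: independent_set_clique_union_join_iff)
    thus "S \<in> (\<Union>b\<in>I. (`) (Pair b) ` Q b)"
      by (auto simp: Q_def card_image inj_on_def)
  next
    fix S assume "S \<in> (\<Union>b\<in>I. (`) (Pair b) ` Q b)"
    then obtain b P where bP: "b \<in> I" "P \<in> Q b" "S = Pair b ` P" by blast
    hence "card S = k" by (auto simp: Q_def card_image inj_on_def)
    moreover from this have "S \<noteq> {}" using k by auto
    ultimately show "S \<in> {S. independent_set (clique_union_join I d n) S \<and> card S = k}"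
      using bP by (auto simp: independent_set_clique_union_join_iff Q_def)
  qed
  moreover have "card (\<Union>b\<in>I. (`) (Pair b) ` Q b) = (\<Sum>b\<in>I. card ((`) (Pair b) ` Q b))"
  proof (rule card_UN_disjoint)
    show "\<forall>b\<in>I. \<forall>b'\<in>I. b \<noteq> b' \<longrightarrow> (`) (Pair b) ` Q b \<inter> (`) (Pair b') ` Q b' = {}"
    proof (intro ballI impI equals0I)
      fix b b' S
      assume "b \<noteq> b'" "S \<in> (`) (Pair b) ` Q b \<inter> (`) (Pair b') ` Q b'"
      then obtain P P' where P: "S = Pair b ` P" "S = Pair b' ` P'" "P \<in> Q b" by blast
      hence "P \<noteq> {}" using k by (auto simp: Q_def)
      thus False using P \<open>b \<noteq> b'\<close> by auto
    qed
  qed (use I fin in auto)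
  moreover have "card ((`) (Pair b) ` Q b) = (d b choose k) * n ^ k" for b
  proof -
    have "card ((`) (Pair b) ` Q b) = card (Q b)"
      by (intro card_image inj_on_subset[OF inj_on_image]) (auto simp: inj_on_def)
    thus ?thesis
      using card_partial_transversals[of "{..<d b}" "{..<n}" k] by (simp add: Q_def)
  qed
  ultimately show ?thesis
    by (simp add: num_independent_sets_def)
qed

lemma graph_with_binomial_independent_set_sequence:
  fixes c :: "nat \<Rightarrow> nat"
  assumes m: "m \<ge> 1" and c: "c m > 0" and n: "n > 0"
  obtains G :: "nat pair_pre_digraph" where "pair_graph G" "independence_number G = m"
    "\<And>k. k \<ge> 1 \<Longrightarrow> num_independent_sets G k = (\<Sum>i=k..m. (i choose k) * c i) * n ^ k"
proof -
  define I where "I = (SIGMA i:{1..m}. {..<c i})"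
  have I: "finite I" by (simp add: I_def)
  obtain G :: "nat pair_pre_digraph" where G: "pair_graph G"
    and num: "\<And>k. num_independent_sets G k = num_independent_sets (clique_union_join I fst n) k"
    using pair_graph_relabel[OF pair_graph_clique_union_join[OF I], where f = to_nat] inj_to_nat
    by blast
  have seq: "num_independent_sets G k = (\<Sum>i=k..m. (i choose k) * c i) * n ^ k" if k: "k \<ge> 1" for k
  proof -
    have "num_independent_sets G k = (\<Sum>b\<in>I. (fst b choose k) * n ^ k)"
      by (simp add: num num_independent_sets_clique_union_join[OF I k])
    also have "\<dots> = (\<Sum>i=1..m. \<Sum>a<c i. (i choose k) * n ^ k)"
      unfolding I_def by (subst sum.Sigma) (auto intro: sum.cong)
    also have "\<dots> = (\<Sum>i=1..m. (i choose k) * c i) * n ^ k"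
      by (simp add: sum_distrib_left mult_ac)
    also have "(\<Sum>i=1..m. (i choose k) * c i) = (\<Sum>i=k..m. (i choose k) * c i)"
      using k by (intro sum.mono_neutral_right) auto
    finally show ?thesis .
  qed
  have "independence_number G = m"
    using seq m c n by (intro independence_number_eqI[OF G]) auto
  with that G seq show ?thesis by blast
qed

section \<open>Solving for the multiplicities\<close>

text \<open>
  The system is solved from \<open>k = m\<close> downwards. The \<open>k\<close>-th equation has coefficient 1 at \<open>c k\<close>, so it
  only has to be checked that the already chosen \<open>c i\<close> with \<open>i > k\<close> contribute at most \<open>s k\<close> to it.
  For these \<open>i\<close> the inequality \<open>(i choose k) \<le> (k + 1) * (i choose (k + 1))\<close> holds, so their contribution
  is at most \<open>k + 1\<close> times the left-hand side of the previous equation, that is,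
  \<open>(k + 1) * s (k + 1)\<close>.
\<close>

lemma nat_binomial_system_solvable:
  fixes s :: "nat \<Rightarrow> nat"
  assumes decay: "\<And>k. 1 \<le> k \<Longrightarrow> k < m \<Longrightarrow> Suc k * s (Suc k) \<le> s k"
  obtains c :: "nat \<Rightarrow> nat" where "\<And>k. 1 \<le> k \<Longrightarrow> k \<le> m \<Longrightarrow> (\<Sum>i=k..m. (i choose k) * c i) = s k"
proof -
  have "\<exists>c::nat \<Rightarrow> nat. \<forall>k\<in>{Suc m - j..m}. (\<Sum>i=k..m. (i choose k) * c i) = s k" if "j \<le> m" for j
    using that
  proof (induction j)
    case 0
    show ?case by simp
  next
    case (Suc j)
    define l where "l = m - j"
    have l: "1 \<le> l" "l \<le> m" "Suc m - j = Suc l" "Suc m - Suc j = l"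
      using Suc.prems by (auto simp: l_def)
    obtain c :: "nat \<Rightarrow> nat" where c: "(\<Sum>i=k..m. (i choose k) * c i) = s k" if "k \<in> {Suc l..m}" for k
      using Suc.IH Suc.prems l by (metis Suc_leD)
    (* r is the part of equation l that is already determined. *)
    define r where "r = (\<Sum>i=Suc l..m. (i choose l) * c i)"
    have "r \<le> s l"
    proof (cases "l = m")
      case True
      thus ?thesis by (simp add: r_def)
    next
      case False
      have "r \<le> (\<Sum>i=Suc l..m. Suc l * ((i choose Suc l) * c i))"
        unfolding r_def
      proof (rule sum_mono)
        fix i assume i: "i \<in> {Suc l..m}"
        have "(i choose l) * 1 \<le> (i choose l) * (i - l)"
          using i by (intro mult_left_mono) auto
        also have "\<dots> = Suc l * (i choose Suc l)"
          using binomial_absorb_comp[of i l] binomial_absorption[of l i] i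
          by (metis binomial_absorption mult.commute)
        finally show "(i choose l) * c i \<le> Suc l * ((i choose Suc l) * c i)"
          using mult_right_mono[of "i choose l" "Suc l * (i choose Suc l)" "c i"]
          by (simp only: mult_1_right mult.assoc zero_le)
      qed
      also have "\<dots> = Suc l * s (Suc l)"
        using c[of "Suc l"] False l by (simp only: flip: sum_distrib_left) simp
      also have "\<dots> \<le> s l"
        using decay[of l] False l by simp
      finally show ?thesis .
    qed
    define c' where "c' = c(l := s l - r)"
    have "(\<Sum>i=k..m. (i choose k) * c' i) = s k" if k: "k \<in> {l..m}" for k
    proof (cases "k = l")
      case True
      have "(\<Sum>i=l..m. (i choose l) * c' i) = c' l + (\<Sum>i=Suc l..m. (i choose l) * c' i)"
        using l by (simp add: sum.atLeast_Suc_atMost)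
      also have "(\<Sum>i=Suc l..m. (i choose l) * c' i) = r"
        unfolding r_def by (intro sum.cong) (auto simp: c'_def)
      finally show ?thesis
        using \<open>r \<le> s l\<close> True by (simp add: c'_def)
    next
      case False
      have "(\<Sum>i=k..m. (i choose k) * c' i) = (\<Sum>i=k..m. (i choose k) * c i)"
        using False k by (intro sum.cong) (auto simp: c'_def)
      thus ?thesis
        using c[of k] False k by simp
    qed
    thus ?case
      using l by metis
  qed
  from this[of m] obtain c :: "nat \<Rightarrow> nat"
    where "\<forall>k\<in>{Suc m - m..m}. (\<Sum>i=k..m. (i choose k) * c i) = s k"
    by blast
  with that[of c] show ?thesis
    by simp
qed

section \<open>Weak orders as rank functions\<close>

text \<open>
  The rank of \<open>k\<close> is the index of its block. Ranks are below \<open>m\<close> because every block contains an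
  element of \<open>{1..m}\<close>, so there are at most \<open>m\<close> blocks.
\<close>

lemma weak_order_rank:
  assumes "weak_order m w"
  obtains \<rho> :: "nat \<Rightarrow> nat" where "\<And>k. k \<in> {1..m} \<Longrightarrow> \<rho> k < m"
    "\<And>a. (\<And>s t. s \<in> {1..m} \<Longrightarrow> t \<in> {1..m} \<Longrightarrow> \<rho> s = \<rho> t \<Longrightarrow> a s = a t) \<Longrightarrow>
         (\<And>s t. s \<in> {1..m} \<Longrightarrow> t \<in> {1..m} \<Longrightarrow> \<rho> s < \<rho> t \<Longrightarrow> a s < a t) \<Longrightarrow>
         seq_induces m a w"
proof -
  have dist: "distinct w" and part: "partition_on {1..m} (set w)"
    using assms by (auto simp: weak_order_def)
  define \<rho> where "\<rho> k = (THE i. i < length w \<and> k \<in> w ! i)" for k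
  have \<rho>: "\<rho> k = i" if "i < length w" "k \<in> w ! i" for i k
    unfolding \<rho>_def
  proof (rule the_equality)
    fix j assume j: "j < length w \<and> k \<in> w ! j"
    hence "w ! i = w ! j"
      using that partition_onD2[OF part] nth_mem unfolding disjoint_def by blast
    thus "j = i"
      using dist j that by (simp add: nth_eq_iff_index_eq)
  qed (use that in simp)
  have block: "w ! i \<subseteq> {1..m}" "w ! i \<noteq> {}" if "i < length w" for i
    using partition_onD1[OF part] partition_onD3[OF part] nth_mem[OF that] by (blast, metis)
  have "{..<length w} \<subseteq> \<rho> ` {1..m}"
  proof
    fix i assume "i \<in> {..<length w}"
    moreover from this obtain k where "k \<in> w ! i" using block by blast
    ultimately show "i \<in> \<rho> ` {1..m}" using \<rho> block by blast
  qed
  hence "card {..<length w} \<le> card (\<rho> ` {1..m})"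
    by (intro card_mono) auto
  also have "\<dots> \<le> m"
    using card_image_le[of "{1..m}" \<rho>] by simp
  finally have len: "length w \<le> m" by simp
  show ?thesis
  proof
    fix k assume "k \<in> {1..m}"
    then obtain B where "B \<in> set w" "k \<in> B"
      using partition_onD1[OF part] by blast
    then obtain i where "i < length w" "k \<in> w ! i"
      by (metis in_set_conv_nth)
    thus "\<rho> k < m" using \<rho> len by simp
  next
    fix a :: "nat \<Rightarrow> real"
    assume eq: "\<And>s t. s \<in> {1..m} \<Longrightarrow> t \<in> {1..m} \<Longrightarrow> \<rho> s = \<rho> t \<Longrightarrow> a s = a t"
      and less: "\<And>s t. s \<in> {1..m} \<Longrightarrow> t \<in> {1..m} \<Longrightarrow> \<rho> s < \<rho> t \<Longrightarrow> a s < a t"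
    show "seq_induces m a w"
      unfolding seq_induces_def
    proof (intro conjI allI impI ballI)
      fix i s t assume "i < length w" "s \<in> w ! i" "t \<in> w ! i"
      thus "a s = a t"
        using \<rho> block by (intro eq) (blast, blast, metis)
    next
      fix i j s t assume "i < length w" "j < length w" "i < j" "s \<in> w ! i" "t \<in> w ! j"
      thus "a s < a t"
        using \<rho> block by (intro less) (blast, blast, metis)
    qed (fact assms)
  qed
qed

section \<open>The realization\<close>

lemma Suc_power_le:
  assumes "m \<ge> 3"
  shows "(m + 1) ^ m \<le> m ^ (m + 1)"
proof -
  have "(1 + 1 / real m) ^ m \<le> exp 1"
    using exp_ge_one_plus_x_over_n_power_n[of m 1] assms by simp
  also have "\<dots> \<le> real m"
    using exp_le assms by linarith
  finally have "(1 + 1 / real m) ^ m * real m ^ m \<le> real m * real m ^ m"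
    by (intro mult_right_mono) auto
  moreover have "(1 + 1 / real m) ^ m * real m ^ m = real ((m + 1) ^ m)"
    using assms by (simp flip: power_mult_distrib add: field_simps)
  ultimately show ?thesis
    by (metis of_nat_le_iff of_nat_mult of_nat_power power_Suc Suc_eq_plus1)
qed

lemma vertex_bound:
  fixes m :: nat
  assumes "m \<ge> 2"
  shows "(m * m - 1 + (m - 1)) * (m + 1) ^ (m - 1) < m ^ (m + 2)"
  (* The case m = 2 is separate because the estimate by m * (m + 1) ^ m exceeds the bound there. *)
proof (cases "m = 2")
  case True
  thus ?thesis by (simp add: numeral_eq_Suc)
next
  case False
  hence m: "m \<ge> 3" using assms by simp
  have "(m * m - 1 + (m - 1)) * (m + 1) ^ (m - 1) < (m * (m + 1)) * (m + 1) ^ (m - 1)"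
    using m by (intro mult_strict_right_mono) (auto simp: algebra_simps)
  also have "\<dots> = m * (m + 1) ^ m"
    using m power_minus_mult[of m "m + 1"] by (simp only: mult.assoc mult.commute)
  also have "\<dots> \<le> m * m ^ (m + 1)"
    using Suc_power_le[OF m] by (rule mult_left_mono) simp
  finally show ?thesis by simp
qed

text \<open>
  The assumption \<open>m \<ge> 2\<close> ensures that \<open>m - 1\<close>, the multiplicity of the union of \<open>m\<close> cliques, is
  positive; without this component the independence number would be less than \<open>m\<close>.
\<close>

lemma graph_with_rank_sequence:
  fixes \<rho> :: "nat \<Rightarrow> nat"
  assumes m: "m \<ge> 2" and \<rho>: "\<And>k. k \<in> {1..m} \<Longrightarrow> \<rho> k < m"
  obtains G :: "nat pair_pre_digraph" where "pair_graph G" "independence_number G = m"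
    "\<And>k. k \<in> {1..m} \<Longrightarrow>
       num_independent_sets G k = (m * m - 1 + \<rho> k - \<rho> m) * (m + 1) ^ (m - 1)"
proof -
  define n where "n = m + 1"
  define u where "u k = m * m - 1 + \<rho> k - \<rho> m" for k
  (* The quotient u k * n ^ (m - 1) / n ^ k. For k = m the shift by the rank of m makes it integral. *)
  define s where "s k = (if k = m then m - 1 else u k * n ^ (m - 1 - k))" for k
  have s: "s k * n ^ k = u k * n ^ (m - 1)" if "k \<in> {1..m}" for k
  proof (cases "k = m")
    case True
    have "(m - 1) * n ^ m = ((m - 1) * n) * n ^ (m - 1)"
      using m power_minus_mult[of m n] by (simp add: mult_ac)
    also have "(m - 1) * n = m * m - 1"
      by (simp add: n_def algebra_simps)
    finally show ?thesis
      using True by (simp add: s_def u_def)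
  next
    case False
    hence "m - 1 - k + k = m - 1" using that by auto
    thus ?thesis
      using False by (simp add: s_def flip: power_add)
  qed
  have "Suc k * s (Suc k) \<le> s k" if k: "1 \<le> k" "k < m" for k
  proof -
    (* The factors u are at least m * (m - 1) and differ by at most m - 1. *)
    have mm: "m \<le> m * m" using m by simp
    have "u (Suc k) \<le> u k + (m - 1)" "m * m - 1 - (m - 1) \<le> u k"
      using \<rho>[of k] \<rho>[of "Suc k"] \<rho>[of m] k mm by (auto simp: u_def)
    moreover have "m * (m - 1) = m * m - 1 - (m - 1)"
      using m by (simp add: algebra_simps)
    ultimately have "m * u (Suc k) \<le> m * u k + u k"
      using mult_left_mono[of "u (Suc k)" "u k + (m - 1)" m] by (simp add: distrib_left)
    hence "m * u (Suc k) \<le> n * u k" by (simp add: n_def)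
    moreover have "Suc k * u (Suc k) \<le> m * u (Suc k)"
      using k by (intro mult_right_mono) auto
    ultimately have "(Suc k * u (Suc k)) * n ^ (m - 1) \<le> (n * u k) * n ^ (m - 1)"
      by (intro mult_right_mono) auto
    also have "\<dots> = s k * n ^ Suc k"
      using s[of k] k by (simp add: mult_ac)
    also have "(Suc k * u (Suc k)) * n ^ (m - 1) = (Suc k * s (Suc k)) * n ^ Suc k"
      using s[of "Suc k"] k by (simp only: mult.assoc) simp
    finally show ?thesis
      by (simp add: n_def)
  qed
  then obtain c :: "nat \<Rightarrow> nat"
    where c: "\<And>k. 1 \<le> k \<Longrightarrow> k \<le> m \<Longrightarrow> (\<Sum>i=k..m. (i choose k) * c i) = s k"
    using nat_binomial_system_solvable[of m s] by blast
  have "c m > 0"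
    using c[of m] m by (simp add: s_def)
  then obtain G :: "nat pair_pre_digraph" where "pair_graph G" "independence_number G = m"
    and num: "\<And>k. k \<ge> 1 \<Longrightarrow> num_independent_sets G k = (\<Sum>i=k..m. (i choose k) * c i) * n ^ k"
    using graph_with_binomial_independent_set_sequence[of m c n] m by (auto simp: n_def)
  moreover have "num_independent_sets G k = (m * m - 1 + \<rho> k - \<rho> m) * (m + 1) ^ (m - 1)"
    if "k \<in> {1..m}" for k
    using num[of k] c[of k] s[OF that] that by (simp add: u_def n_def)
  ultimately show ?thesis
    using that by blast
qed

theorem theorem1p5:
  fixes m :: nat and w :: "nat set list"
  assumes "m \<ge> 1" and "weak_order m w"
  shows "\<exists>G :: nat pair_pre_digraph.
           pair_graph G \<and> independence_number G = m \<and>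
           card (pverts G) \<le> m ^ (m + 2) \<and>
           (m \<ge> 2 \<longrightarrow> card (pverts G) < m ^ (m + 2)) \<and>
           graph_induces G w"
proof -
  obtain \<rho> :: "nat \<Rightarrow> nat" where \<rho>: "\<And>k. k \<in> {1..m} \<Longrightarrow> \<rho> k < m"
    and induces: "\<And>a. (\<And>s t. s \<in> {1..m} \<Longrightarrow> t \<in> {1..m} \<Longrightarrow> \<rho> s = \<rho> t \<Longrightarrow> a s = a t) \<Longrightarrow>
         (\<And>s t. s \<in> {1..m} \<Longrightarrow> t \<in> {1..m} \<Longrightarrow> \<rho> s < \<rho> t \<Longrightarrow> a s < a t) \<Longrightarrow>
         seq_induces m a w"
    using weak_order_rank[OF assms(2)] by blast
  show ?thesis
  proof (cases "m = 1")
    case True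
    (* The single vertex: the general construction would give the empty graph here. *)
    obtain G :: "nat pair_pre_digraph" where G: "pair_graph G" "independence_number G = 1"
      and num: "\<And>k. k \<ge> 1 \<Longrightarrow> num_independent_sets G k = (\<Sum>i=k..1. (i choose k) * 1) * 1 ^ k"
      using graph_with_binomial_independent_set_sequence[of 1 "\<lambda>_. 1" 1] by auto
    have "card (pverts G) = 1"
      using num_independent_sets_1_eq_card[OF G(1)] num[of 1] by simp
    moreover have "graph_induces G w"
      unfolding graph_induces_def G(2) True[symmetric] using True by (intro induces) auto
    ultimately show ?thesis
      using G True by auto
  next
    case False
    hence m: "m \<ge> 2" using assms(1) by simp
    define N where "N = (m + 1) ^ (m - 1)"
    obtain G :: "nat pair_pre_digraph" where G: "pair_graph G" "independence_number G = m"
      and num: "\<And>k. k \<in> {1..m} \<Longrightarrow> num_independent_sets G k = (m * m - 1 + \<rho> k - \<rho> m) * N"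
      using graph_with_rank_sequence[where \<rho> = \<rho>, OF m] \<rho> unfolding N_def by blast
    have "card (pverts G) = (m * m - 1 + \<rho> 1 - \<rho> m) * N"
      using num_independent_sets_1_eq_card[OF G(1)] num[of 1] m by simp
    also have "\<dots> \<le> (m * m - 1 + (m - 1)) * N"
      using \<rho>[of 1] m by (intro mult_right_mono) auto
    also have "\<dots> < m ^ (m + 2)"
      using vertex_bound[OF m] by (simp add: N_def)
    finally have card: "card (pverts G) < m ^ (m + 2)" .
    have "seq_induces m (\<lambda>k. real (num_independent_sets G k)) w"
    proof (rule induces)
      fix s t assume st: "s \<in> {1..m}" "t \<in> {1..m}" "\<rho> s < \<rho> t"
      have "\<rho> m < m" "m * 1 \<le> m * m"
        using \<rho>[of m] m by auto
      hence "\<rho> m \<le> m * m - 1" by linarith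
      hence "m * m - 1 + \<rho> s - \<rho> m < m * m - 1 + \<rho> t - \<rho> m"
        using st by linarith
      hence "num_independent_sets G s < num_independent_sets G t"
        unfolding num[OF st(1)] num[OF st(2)]
        by (rule mult_strict_right_mono) (simp add: N_def)
      thus "real (num_independent_sets G s) < real (num_independent_sets G t)"
        by simp
    qed (simp add: num)
    with G card show ?thesis
      by (auto simp: graph_induces_def)
  qed
qed

end
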